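(* Let $N\ge 3$ be an integer, let $z\in\mathbb{R}$, and for $j=0,1,2$ let $a_j,b_j:\mathbb{Z}\to\mathbb{R}$ with $a_j(n)<0$ for all $n\in\mathbb{Z}$, and let $u_j$ be a solution of $\tau_ju=zu$. Suppose that at least one of the following holds: (A) $W_j(u_0,u_1)\,u_0(j+1)u_1(j+1)\le 0$ and $W_j(u_1,u_2)\,u_1(j+1)u_2(j+1)\le 0$ for all $j=0,\dots,N-2$; (B) $a_0=a_1=a_2$ and $b_0(j)\ge b_1(j)\ge b_2(j)$ for all $j=1,\dots,N-1$. If $0$ and $N-2$ are positive nodes of $W(u_0,u_1)$, i.e. $\#_0(u_0,u_1)=\#_{N-2}(u_0,u_1)=1$, then $W(u_0,u_2)$ has at least one positive node at $0,\dots,N-2$, i.e. $\#_k(u_0,u_2)=1$ for some $k\in\{0,\dots,N-2\}$.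
   Context: For $a,b:\mathbb{Z}\to\mathbb{R}$ the difference expression is $(\tau u)(n)=a(n)u(n+1)+a(n-1)u(n-1)+b(n)u(n)$, $n\in\mathbb{Z}$; $\tau_j$ is built from $a_j,b_j$. A solution of $\tau u=zu$ is a real sequence $u:\mathbb{Z}\to\mathbb{R}$, $u\not\equiv0$, satisfying the equation for all $n\in\mathbb{Z}$. The (modified) Wronskian is $W_n=W_n(u_i,u_j)=u_i(n)a_j(n)u_j(n+1)-u_j(n)a_i(n)u_i(n+1)$. Define - $\#_n(u_i,u_j)=1$ if $W_{n+1}u_i(n+1)u_j(n+1)>0$ and either $W_nW_{n+1}<0$ or ($W_n=0$ and $W_{n+1}\ne0$); - $\#_n(u_i,u_j)=-1$ if $W_nu_i(n+1)u_j(n+1)>0$ and either $W_nW_{n+1}<0$ or ($W_n\neq0$ and $W_{n+1}=0$); - $\#_n(u_i,u_j)=0$ otherwise. The Wronskian $W(u_i,u_j)$ has a (weighted) node at $n$ if $\#_n(u_i,u_j)\neq0$, and the node is positive if $\#_n(u_i,u_j)=1$. *)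

theory Defs
  imports Complex_Main
begin

definition jacobi_diff :: "(int \<Rightarrow> real) \<Rightarrow> (int \<Rightarrow> real) \<Rightarrow> (int \<Rightarrow> real) \<Rightarrow> int \<Rightarrow> real" where
  "jacobi_diff a b u n = a n * u (n + 1) + a (n - 1) * u (n - 1) + b n * u n"

definition is_solution :: "(int \<Rightarrow> real) \<Rightarrow> (int \<Rightarrow> real) \<Rightarrow> real \<Rightarrow> (int \<Rightarrow> real) \<Rightarrow> bool" where
  "is_solution a b z u \<longleftrightarrow> u \<noteq> (\<lambda>_. 0) \<and> (\<forall>n. jacobi_diff a b u n = z * u n)"

text \<open>
  The modified Wronskian $W_n(u_i, u_j)$ depends on the off-diagonal coefficients of both
  difference expressions; \<open>ai\<close> belongs to \<open>ui\<close> and \<open>aj\<close> to \<open>uj\<close>.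
\<close>

definition wronskian ::
  "(int \<Rightarrow> real) \<Rightarrow> (int \<Rightarrow> real) \<Rightarrow> (int \<Rightarrow> real) \<Rightarrow> (int \<Rightarrow> real) \<Rightarrow> int \<Rightarrow> real" where
  "wronskian ai aj ui uj n = ui n * aj n * uj (n + 1) - uj n * ai n * ui (n + 1)"

text \<open>
  The weighted node count $\#_n(u_i, u_j)$. The conditions for the values $1$ and $-1$ exclude
  each other, so the order of the case distinction is immaterial.
\<close>

definition node ::
  "(int \<Rightarrow> real) \<Rightarrow> (int \<Rightarrow> real) \<Rightarrow> (int \<Rightarrow> real) \<Rightarrow> (int \<Rightarrow> real) \<Rightarrow> int \<Rightarrow> int" where
  "node ai aj ui uj n =
    (let W = wronskian ai aj ui uj; p = ui (n + 1) * uj (n + 1) in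
     if W (n + 1) * p > 0 \<and> (W n * W (n + 1) < 0 \<or> W n = 0 \<and> W (n + 1) \<noteq> 0) then 1
     else if W n * p > 0 \<and> (W n * W (n + 1) < 0 \<or> W n \<noteq> 0 \<and> W (n + 1) = 0) then - 1
     else 0)"

end

theory Submission
  imports Defs
begin

text \<open>
  In Pruefer coordinates \<open>(u n, - a n * u (n + 1))\<close>, a step of the recursion is a clockwise
  rotation by a right angle (up to scaling) followed by a vertical shear. Hence each solution has a
  lifted angle, and the weighted node at $n$ is the increment of $\lceil\Delta/\pi\rceil$, where
  $\Delta$ is the difference of the lifted angles of the two solutions. Either hypothesis excludes
  negative nodes of $W(u_0,u_1)$ and $W(u_1,u_2)$, so the two ceilings increase in total by at
  least $2$ between $0$ and $N-1$. The ceiling is additive up to an error in $\{-1,0\}$, so the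
  ceiling for the pair $(u_0,u_2)$ increases by at least $1$.
\<close>

section \<open>Pruefer angles modulo \<open>pi\<close>\<close>

text \<open>The representative modulo \<open>pi\<close> above \<open>- pi / 2\<close> and up to
  \<open>pi / 2\<close>, measured from the second Pruefer axis.\<close>

definition angle :: "(int \<Rightarrow> real) \<Rightarrow> (int \<Rightarrow> real) \<Rightarrow> int \<Rightarrow> real" where
  "angle a u n = (if u (n + 1) = 0 then pi / 2 else arctan (u n / (- a n * u (n + 1))))"

text \<open>The step from \<open>n - 1\<close> to \<open>n\<close> carries the range of
  \<open>angle\<close> into the angles above 0 and up to \<open>pi\<close>. A flip says that the new
  representative needs an extra \<open>pi\<close> to lie there; the end \<open>pi\<close> is the
  case \<open>u n = 0\<close>.\<close>

definition flip :: "(int \<Rightarrow> real) \<Rightarrow> int \<Rightarrow> int" where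
  "flip u n = of_bool (u n = 0 \<or> u n * u (n + 1) < 0)"

text \<open>
  The lifted angle is \<open>angle a u n\<close> plus $\pi$ times the number of flips so far, so the ceiling
  of an angle difference is a difference of flip counts plus this correction.
\<close>

definition ahead ::
  "(int \<Rightarrow> real) \<Rightarrow> (int \<Rightarrow> real) \<Rightarrow> (int \<Rightarrow> real) \<Rightarrow> (int \<Rightarrow> real) \<Rightarrow> int \<Rightarrow> int" where
  "ahead ai aj ui uj n = of_bool (angle ai ui n < angle aj uj n)"

text \<open>Totality of the order excludes the value 1, transitivity excludes -2.\<close>

lemma ahead_triangle:
  "ahead a0 a2 u0 u2 n - ahead a0 a1 u0 u1 n - ahead a1 a2 u1 u2 n \<in> {- 1, 0}"
  by (auto simp: ahead_def)

section \<open>The Jacobi recursion\<close>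

lemma solution_step:
  assumes "is_solution a b z u"
  shows "a n * u (n + 1) = (z - b n) * u n - a (n - 1) * u (n - 1)"
proof -
  have "a n * u (n + 1) + a (n - 1) * u (n - 1) + b n * u n = z * u n"
    using assms by (simp add: is_solution_def jacobi_diff_def)
  then show ?thesis unfolding left_diff_distrib by linarith
qed

text \<open>As \<open>a\<close> never vanishes, two adjacent zeros would propagate in both
  directions and make the solution trivial.\<close>

lemma solution_no_consecutive_zeros:
  assumes sol: "is_solution a b z u" and a: "\<And>n. a n < 0" and zero: "u m = 0"
  shows "u (m + 1) \<noteq> 0"
proof
  assume zero': "u (m + 1) = 0"
  have "u n = 0 \<and> u (n + 1) = 0" for n
  proof (induction n rule: int_induct[where k = m])
    case base
    show ?case using zero zero' by simp
  next
    case (step1 i)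
    with solution_step[OF sol, of "i + 1"] a[of "i + 1"] show ?case
      by (simp add: add.assoc)
  next
    case (step2 i)
    with solution_step[OF sol, of i] a[of "i - 1"] show ?case by simp
  qed
  then show False using sol by (auto simp: is_solution_def)
qed

section \<open>Wronskian signs and the order of angles\<close>

text \<open>\<open>arctan\<close> is increasing, and its two arguments differ by a positive multiple
  of the weighted Wronskian.\<close>

lemma angle_less_iff:
  assumes "ai n < 0" "aj n < 0" "ui (n + 1) \<noteq> 0" "uj (n + 1) \<noteq> 0"
  shows "angle ai ui n < angle aj uj n
         \<longleftrightarrow> wronskian ai aj ui uj n * (ui (n + 1) * uj (n + 1)) > 0"
proof -
  let ?c = "(ai n * aj n) * ((ui (n + 1))\<^sup>2 * (uj (n + 1))\<^sup>2)"
  have c: "?c > 0" using assms by (simp add: mult_neg_neg)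
  have "uj n / (- aj n * uj (n + 1)) - ui n / (- ai n * ui (n + 1))
        = wronskian ai aj ui uj n * (ui (n + 1) * uj (n + 1)) / ?c"
    using assms by (simp add: wronskian_def field_simps power2_eq_square)
  then have "ui n / (- ai n * ui (n + 1)) < uj n / (- aj n * uj (n + 1))
        \<longleftrightarrow> wronskian ai aj ui uj n * (ui (n + 1) * uj (n + 1)) / ?c > 0"
    by linarith
  then show ?thesis
    using assms c by (simp add: angle_def arctan_less_iff zero_less_divide_iff)
qed

lemma angle_less_of_zero:
  assumes "ui (n + 1) \<noteq> 0" "uj (n + 1) = 0"
  shows "angle ai ui n < angle aj uj n" "\<not> angle aj uj n < angle ai ui n"
  using assms arctan_ubound[of "ui n / (- ai n * ui (n + 1))"] by (simp_all add: angle_def)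

text \<open>With the flips added, both angles lie strictly between 0 and \<open>pi\<close>, where
  the cotangent decreases; comparing the cotangents \<open>- a n * u (n + 1) / u n\<close> gives the
  sign on the right.\<close>

lemma flip_ahead:
  assumes ai: "ai n < 0" and aj: "aj n < 0" and ui: "ui n \<noteq> 0" and uj: "uj n \<noteq> 0"
  shows "flip uj n - flip ui n + ahead ai aj ui uj n
         = of_bool (wronskian ai aj ui uj n * (ui n * uj n) > 0)"
proof -
  define A B P Q where "A = ui n * ui (n + 1)" and "B = uj n * uj (n + 1)"
    and "P = ui n * uj n" and "Q = ui (n + 1) * uj (n + 1)"
  define W where "W = wronskian ai aj ui uj n"
  have sq: "(ui n)\<^sup>2 > 0" "(uj n)\<^sup>2 > 0" using ui uj by auto
  \<comment> \<open>Up to a positive factor this is the difference of the two cotangents, whose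
    signs are those of \<open>A\<close> and \<open>B\<close>.\<close>
  have WP: "W * P = (- ai n) * (uj n)\<^sup>2 * A - (- aj n) * (ui n)\<^sup>2 * B"
    by (simp add: W_def P_def A_def B_def wronskian_def algebra_simps power2_eq_square)
  have flips: "flip ui n = of_bool (A < 0)" "flip uj n = of_bool (B < 0)"
    using ui uj by (simp_all add: flip_def A_def B_def)
  have pos: "(- ai n) * (uj n)\<^sup>2 > 0" "(- aj n) * (ui n)\<^sup>2 > 0"
    using ai aj sq by (simp_all add: mult_neg_pos)
  have mixed: "W * P > 0" if "A \<ge> 0" "B < 0"
    using mult_nonneg_nonneg[OF less_imp_le[OF pos(1)] that(1)] mult_pos_neg[OF pos(2) that(2)] WP
    by linarith
  have mixed': "W * P < 0" if "A < 0" "B \<ge> 0"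
    using mult_pos_neg[OF pos(1) that(1)] mult_nonneg_nonneg[OF less_imp_le[OF pos(2)] that(2)] WP
    by linarith
  have "of_bool (B < 0) - of_bool (A < 0) + ahead ai aj ui uj n = of_bool (W * P > 0)"
  proof (cases "A = 0 \<or> B = 0")
    case True
    consider "A = 0" "B = 0" | "A = 0" "B < 0" | "A = 0" "B > 0"
      | "A < 0" "B = 0" | "A > 0" "B = 0"
      using True by linarith
    then show ?thesis
    proof cases
      case 1
      then show ?thesis using ui uj by (simp add: ahead_def angle_def A_def B_def W_def wronskian_def)
    next
      case 2
      then have "ahead ai aj ui uj n = 0"
        using angle_less_of_zero(2)[of uj n ui ai aj] ui
        by (auto simp: ahead_def A_def B_def mult_less_0_iff zero_less_mult_iff)
      then show ?thesis using 2 mixed by simp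
    next
      case 3
      then have "ahead ai aj ui uj n = 0"
        using angle_less_of_zero(2)[of uj n ui ai aj] ui
        by (auto simp: ahead_def A_def B_def mult_less_0_iff zero_less_mult_iff)
      moreover have "W * P < 0" using 3 mult_pos_pos[OF pos(2) \<open>B > 0\<close>] WP by simp
      ultimately show ?thesis using 3 by simp
    next
      case 4
      then have "ahead ai aj ui uj n = 1"
        using angle_less_of_zero(1)[of ui n uj ai aj] uj
        by (auto simp: ahead_def A_def B_def mult_less_0_iff zero_less_mult_iff)
      then show ?thesis using 4 mixed' by simp
    next
      case 5
      then have "ahead ai aj ui uj n = 1"
        using angle_less_of_zero(1)[of ui n uj ai aj] uj
        by (auto simp: ahead_def A_def B_def mult_less_0_iff zero_less_mult_iff)
      moreover have "W * P > 0" using 5 mult_pos_pos[OF pos(1) \<open>A > 0\<close>] WP by simp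
      ultimately show ?thesis using 5 by simp
    qed
  next
    case False
    then have nz: "ui (n + 1) \<noteq> 0" "uj (n + 1) \<noteq> 0" by (auto simp: A_def B_def)
    have ahead: "ahead ai aj ui uj n = of_bool (W * Q > 0)"
      using angle_less_iff[of ai n aj ui uj, OF ai aj nz] by (simp add: ahead_def W_def Q_def)
    \<comment> \<open>The signs of \<open>W * P\<close> and \<open>W * Q\<close> differ exactly when those of \<open>A\<close> and \<open>B\<close> do.\<close>
    have prod: "(W * P) * (W * Q) = W\<^sup>2 * (A * B)"
      by (simp add: P_def Q_def A_def B_def algebra_simps power2_eq_square)
    have AB: "A * B > 0 \<longleftrightarrow> (A < 0 \<longleftrightarrow> B < 0)" "A * B < 0 \<longleftrightarrow> (A < 0 \<longleftrightarrow> B > 0)"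
      using False by (auto simp: zero_less_mult_iff mult_less_0_iff)
    have same: "W * P > 0 \<longleftrightarrow> W * Q > 0" if "A < 0 \<longleftrightarrow> B < 0" "W \<noteq> 0"
    proof -
      have "(W * P) * (W * Q) > 0" unfolding prod using that AB(1) by simp
      then show ?thesis unfolding zero_less_mult_iff[of "W * P" "W * Q"] by linarith
    qed
    have opposite: "W * P > 0 \<longleftrightarrow> W * Q < 0" if "A < 0 \<longleftrightarrow> B > 0" "W \<noteq> 0"
    proof -
      have "(W * P) * (W * Q) < 0" unfolding prod using that AB(2) by (simp add: mult_pos_neg)
      then show ?thesis unfolding mult_less_0_iff[of "W * P" "W * Q"] by linarith
    qed
    consider "A < 0 \<longleftrightarrow> B < 0" | "A \<ge> 0" "B < 0" | "A < 0" "B \<ge> 0" by linarith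
    then show ?thesis
    proof cases
      case 1
      then show ?thesis using same by (cases "W = 0") (simp_all add: ahead)
    next
      case 2
      with mixed have "W * P > 0" .
      moreover from this have "W \<noteq> 0" by auto
      ultimately have "W * Q < 0" using opposite 2 False by auto
      with 2 \<open>W * P > 0\<close> show ?thesis by (simp add: ahead)
    next
      case 3
      with mixed' have "W * P < 0" .
      moreover from this have "W \<noteq> 0" by auto
      moreover from this have "W * Q \<noteq> 0" using nz by (simp add: Q_def)
      ultimately have "W * Q > 0" using opposite 3 False by (metis not_less_iff_gr_or_eq order_le_less)
      with 3 \<open>W * P < 0\<close> show ?thesis by (simp add: ahead)
    qed
  qed
  then show ?thesis by (simp add: flips W_def P_def)
qed

section \<open>Nodes as increments\<close>

text \<open>Weighted by the nonzero \<open>p\<close>, a node is a passage between nonpositive and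
  positive values; the zero cases of \<open>node\<close> fit the strict inequality.\<close>

lemma node_eq:
  assumes "ui (n + 1) \<noteq> 0" "uj (n + 1) \<noteq> 0"
  shows "node ai aj ui uj n
         = of_bool (wronskian ai aj ui uj (n + 1) * (ui (n + 1) * uj (n + 1)) > 0)
           - of_bool (wronskian ai aj ui uj n * (ui (n + 1) * uj (n + 1)) > 0)"
proof -
  define p where "p = ui (n + 1) * uj (n + 1)"
  have "p \<noteq> 0" using assms by (simp add: p_def)
  then show ?thesis
    unfolding node_def Let_def p_def[symmetric]
    by (auto simp: zero_less_mult_iff mult_less_0_iff not_less)
qed

text \<open>At a zero of \<open>ui\<close> its lifted angle sits at the closed end
  \<open>pi\<close>, above that of \<open>uj\<close>. The ceiling is then 0, or 1 with the roles
  exchanged; the second claim is the negated exchanged form.\<close>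

lemma flip_ahead_of_zero:
  assumes sol: "is_solution ai bi z ui" and ai: "\<And>n. ai n < 0"
    and ui: "ui n = 0" and uj: "uj n \<noteq> 0" and aj: "aj n < 0"
  shows "flip uj n - flip ui n + ahead ai aj ui uj n = 0"
    and "flip uj n - flip ui n - ahead aj ai uj ui n = - 1"
proof -
  have nz: "ui (n + 1) \<noteq> 0" by (rule solution_no_consecutive_zeros[OF sol ai ui])
  have angle_i: "angle ai ui n = 0" using ui nz by (simp add: angle_def)
  show "flip uj n - flip ui n + ahead ai aj ui uj n = 0"
    and "flip uj n - flip ui n - ahead aj ai uj ui n = - 1"
    using uj aj nz pi_gt_zero
    by (auto simp: flip_def ahead_def angle_i ui angle_def zero_less_divide_iff
        divide_less_0_iff mult_less_0_iff zero_less_mult_iff not_less)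
qed

text \<open>The quarter turn moves both angles alike, so only the shear can change their order.
  \<open>angle_less_iff\<close> reads the order before the shear, \<open>flip_ahead\<close> after
  it, both with the weight of \<open>node_eq\<close>.\<close>

lemma node_telescope:
  assumes soli: "is_solution ai bi z ui" and solj: "is_solution aj bj z uj"
    and ai: "\<And>n. ai n < 0" and aj: "\<And>n. aj n < 0"
  shows "node ai aj ui uj n = flip uj (n + 1) - flip ui (n + 1)
           + ahead ai aj ui uj (n + 1) - ahead ai aj ui uj n"
proof -
  consider "ui (n + 1) \<noteq> 0" "uj (n + 1) \<noteq> 0" | "ui (n + 1) = 0" "uj (n + 1) \<noteq> 0"
    | "ui (n + 1) \<noteq> 0" "uj (n + 1) = 0" | "ui (n + 1) = 0" "uj (n + 1) = 0"
    by blast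
  then show ?thesis
  proof cases
    case 1
    then show ?thesis
      using flip_ahead[of ai "n + 1" aj ui uj, OF ai aj 1]
        angle_less_iff[of ai n aj ui uj, OF ai aj 1]
      by (simp add: node_eq ahead_def)
  next
    \<comment> \<open>The angle of \<open>ui\<close> is maximal both before and after the step, so
      the ceiling does not move.\<close>
    case 2
    then have "node ai aj ui uj n = 0" by (simp add: node_def Let_def)
    moreover have "ahead ai aj ui uj n = 0"
      using angle_less_of_zero(2)[of uj n ui ai aj, OF 2(2,1)] by (simp add: ahead_def)
    ultimately show ?thesis using flip_ahead_of_zero(1)[of ai bi z ui "n + 1" uj aj, OF soli ai 2 aj] by simp
  next
    case 3
    then have "node ai aj ui uj n = 0" by (simp add: node_def Let_def)
    moreover have "ahead ai aj ui uj n = 1"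
      using angle_less_of_zero(1)[of ui n uj ai aj, OF 3] by (simp add: ahead_def)
    ultimately show ?thesis using flip_ahead_of_zero(2)[of aj bj z uj "n + 1" ui ai, OF solj aj 3(2,1) ai] by simp
  next
    case 4
    then show ?thesis
      using solution_no_consecutive_zeros[OF soli ai 4(1)]
        solution_no_consecutive_zeros[OF solj aj 4(2)]
      by (simp add: node_def Let_def flip_def ahead_def angle_def)
  qed
qed

section \<open>Excluding negative nodes\<close>

text \<open>Discrete Green identity: the recursion eliminates the values at \<open>n + 2\<close>,
  the terms with \<open>z\<close> cancel, and the shared \<open>a\<close> restores the previous
  Wronskian.\<close>

lemma wronskian_step:
  assumes "is_solution a bi z ui" "is_solution a bj z uj"
  shows "wronskian a a ui uj (n + 1)
         = wronskian a a ui uj n + (bi (n + 1) - bj (n + 1)) * (ui (n + 1) * uj (n + 1))"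
proof -
  have "wronskian a a ui uj (n + 1)
        = ui (n + 1) * (a (n + 1) * uj (n + 1 + 1)) - uj (n + 1) * (a (n + 1) * ui (n + 1 + 1))"
    by (simp add: wronskian_def algebra_simps)
  also have "\<dots> = wronskian a a ui uj n + (bi (n + 1) - bj (n + 1)) * (ui (n + 1) * uj (n + 1))"
    unfolding solution_step[OF assms(1)] solution_step[OF assms(2)]
    by (simp add: wronskian_def algebra_simps)
  finally show ?thesis .
qed

text \<open>A negative node needs the weighted Wronskian to lose positivity. The premise is vacuous
  under (A) and follows from \<open>wronskian_step\<close> under (B).\<close>

lemma node_nonneg:
  assumes "wronskian ai aj ui uj n * (ui (n + 1) * uj (n + 1)) > 0 \<Longrightarrow>
    wronskian ai aj ui uj (n + 1) * (ui (n + 1) * uj (n + 1)) > 0"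
  shows "node ai aj ui uj n \<ge> 0"
proof (cases "ui (n + 1) = 0 \<or> uj (n + 1) = 0")
  case True
  then show ?thesis by (auto simp: node_def Let_def)
next
  case False
  then show ?thesis using assms by (simp add: node_eq)
qed

lemma node_nonneg_of_potential_le:
  assumes "is_solution a bi z ui" "is_solution a bj z uj" "bi (n + 1) \<ge> bj (n + 1)"
  shows "node a a ui uj n \<ge> 0"
proof (rule node_nonneg)
  let ?p = "ui (n + 1) * uj (n + 1)"
  assume pos: "wronskian a a ui uj n * ?p > 0"
  have "(bi (n + 1) - bj (n + 1)) * (?p * ?p) \<ge> 0" using assms(3) by simp
  then show "wronskian a a ui uj (n + 1) * ?p > 0"
    using pos by (simp only: wronskian_step[OF assms(1,2)] distrib_right mult.assoc)
qed

section \<open>Summing the nodes\<close>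

lemma sum_int_telescope:
  fixes f :: "int \<Rightarrow> 'a::ab_group_add"
  assumes "m \<ge> 0"
  shows "(\<Sum>n=0..m. f (n + 1) - f n) = f (m + 1) - f 0"
  using assms
proof (induction m rule: int_ge_induct)
  case (step i)
  then have "{0..i + 1} = insert (i + 1) {0..i}" by auto
  then show ?case using step by simp
qed simp

theorem theorem5p5:
  fixes N :: int and z :: real
    and a0 a1 a2 b0 b1 b2 u0 u1 u2 :: "int \<Rightarrow> real"
  assumes N: "N \<ge> 3"
    and a0_neg: "\<And>n. a0 n < 0" and a1_neg: "\<And>n. a1 n < 0" and a2_neg: "\<And>n. a2 n < 0"
    and u0: "is_solution a0 b0 z u0"
    and u1: "is_solution a1 b1 z u1"
    and u2: "is_solution a2 b2 z u2"
    and A_or_B: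
      "(\<forall>j\<in>{0..N - 2}. wronskian a0 a1 u0 u1 j * u0 (j + 1) * u1 (j + 1) \<le> 0 \<and>
                       wronskian a1 a2 u1 u2 j * u1 (j + 1) * u2 (j + 1) \<le> 0)
       \<or> (a0 = a1 \<and> a1 = a2 \<and> (\<forall>j\<in>{1..N - 1}. b0 j \<ge> b1 j \<and> b1 j \<ge> b2 j))"
    and node_left: "node a0 a1 u0 u1 0 = 1"
    and node_right: "node a0 a1 u0 u1 (N - 2) = 1"
  shows "\<exists>k\<in>{0..N - 2}. node a0 a2 u0 u2 k = 1"
proof -
  have nonneg: "node a0 a1 u0 u1 n \<ge> 0 \<and> node a1 a2 u1 u2 n \<ge> 0" if n: "n \<in> {0..N - 2}" for n
    using A_or_B
  proof
    assume "\<forall>j\<in>{0..N - 2}. wronskian a0 a1 u0 u1 j * u0 (j + 1) * u1 (j + 1) \<le> 0 \<and>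
                       wronskian a1 a2 u1 u2 j * u1 (j + 1) * u2 (j + 1) \<le> 0"
    then have "wronskian a0 a1 u0 u1 n * (u0 (n + 1) * u1 (n + 1)) \<le> 0"
      "wronskian a1 a2 u1 u2 n * (u1 (n + 1) * u2 (n + 1)) \<le> 0"
      using n by (simp_all add: mult.assoc)
    then show ?thesis by (auto intro!: node_nonneg)
  next
    assume B: "a0 = a1 \<and> a1 = a2 \<and> (\<forall>j\<in>{1..N - 1}. b0 j \<ge> b1 j \<and> b1 j \<ge> b2 j)"
    then have "b0 (n + 1) \<ge> b1 (n + 1)" "b1 (n + 1) \<ge> b2 (n + 1)" using n by auto
    then show ?thesis using B u0 u1 u2 node_nonneg_of_potential_le by metis
  qed
  \<comment> \<open>The flips of the three pairs cancel, leaving only this telescoping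
    correction.\<close>
  define E where "E n = ahead a0 a2 u0 u2 n - ahead a0 a1 u0 u1 n - ahead a1 a2 u1 u2 n" for n
  have "node a0 a2 u0 u2 n
        = node a0 a1 u0 u1 n + node a1 a2 u1 u2 n + (E (n + 1) - E n)" for n
    unfolding E_def
      node_telescope[where ai = a0 and aj = a1, OF u0 u1 a0_neg a1_neg]
      node_telescope[where ai = a1 and aj = a2, OF u1 u2 a1_neg a2_neg]
      node_telescope[where ai = a0 and aj = a2, OF u0 u2 a0_neg a2_neg]
    by simp
  then have "(\<Sum>n=0..N - 2. node a0 a2 u0 u2 n)
      = (\<Sum>n=0..N - 2. node a0 a1 u0 u1 n) + (\<Sum>n=0..N - 2. node a1 a2 u1 u2 n)
        + (\<Sum>n=0..N - 2. E (n + 1) - E n)"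
    by (simp only: sum.distrib)
  moreover have "(\<Sum>n=0..N - 2. E (n + 1) - E n) = E (N - 1) - E 0"
    using sum_int_telescope[of "N - 2" E] N by simp
  moreover have "E (N - 1) - E 0 \<ge> - 1"
    using ahead_triangle[of a0 a2 u0 u2 "N - 1" a1 u1] ahead_triangle[of a0 a2 u0 u2 0 a1 u1]
    by (auto simp: E_def)
  ultimately have sum: "(\<Sum>n=0..N - 2. node a0 a2 u0 u2 n) \<ge>
      (\<Sum>n=0..N - 2. node a0 a1 u0 u1 n) + (\<Sum>n=0..N - 2. node a1 a2 u1 u2 n) - 1"
    by linarith
  \<comment> \<open>Since \<open>N\<close> is at least 3, the indices 0 and \<open>N - 2\<close> are
    distinct: a gain of 2 against a loss of at most 1.\<close>
  have "2 = (\<Sum>n\<in>{0, N - 2}. node a0 a1 u0 u1 n)"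
    using N node_left node_right by simp
  also have "\<dots> \<le> (\<Sum>n=0..N - 2. node a0 a1 u0 u1 n)"
    using N nonneg by (intro sum_mono2) auto
  finally have "(\<Sum>n=0..N - 2. node a0 a2 u0 u2 n) > 0"
    using sum sum_nonneg[of "{0..N - 2}" "node a1 a2 u1 u2"] nonneg by auto
  then obtain k where "k \<in> {0..N - 2}" "node a0 a2 u0 u2 k > 0"
    by (meson not_less sum_nonpos)
  \<comment> \<open>The only positive value of \<open>node\<close> is 1.\<close>
  then show ?thesis by (auto simp: node_def Let_def split: if_splits)
qed

end
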